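(* Let $n \ge 3$ and let $A = (a_{ij}) \in S^+_{n,n-1}$. Then \[ \det(A)\geq -\frac{1}{n-2}\left(\frac{n-1}{n-2}\right)^{n-1}a_{11}\cdots a_{nn}. \] Moreover, the inequality is strict when $A \in S^{++}_{n,n-1}$.
   Context: $\mathcal{S}^n$ denotes the set of real symmetric $n\times n$ matrices. A principal submatrix of size $k$ of $A$ is a submatrix whose rows and columns are indexed by the same $k$-element subset of $\{1,\dots,n\}$. PSD means positive semidefinite and PD means positive definite. Define \[ S^+_{n,n-1} := \{X \in \mathcal{S}^n \mid \text{all principal submatrices of } X \text{ of size } n-1 \text{ are PSD and } \det(X) < 0\}, \] \[ S^{++}_{n,n-1} := \{X \in \mathcal{S}^n \mid \text{all principal submatrices of } X \text{ of size } n-1 \text{ are PD and } \det(X) < 0\}. \] Note that the condition $\det(X)<0$ is part of both definitions. *)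

theory Defs
  imports Complex_Main "Jordan_Normal_Form.Determinant" "Jordan_Normal_Form.DL_Submatrix"
begin

definition sym_mats :: "nat \<Rightarrow> real mat set" where
  "sym_mats n = {A \<in> carrier_mat n n. transpose_mat A = A}"

definition psd_mat :: "real mat \<Rightarrow> bool" where
  "psd_mat A \<longleftrightarrow> A \<in> sym_mats (dim_row A) \<and>
     (\<forall>x \<in> carrier_vec (dim_row A). 0 \<le> x \<bullet> (A *\<^sub>v x))"

definition pd_mat :: "real mat \<Rightarrow> bool" where
  "pd_mat A \<longleftrightarrow> A \<in> sym_mats (dim_row A) \<and>
     (\<forall>x \<in> carrier_vec (dim_row A). x \<noteq> 0\<^sub>v (dim_row A) \<longrightarrow> 0 < x \<bullet> (A *\<^sub>v x))"

(* Rows and columns of a mat are numbered from 0, so the index set {1, ..., n} is {0..<n}. *)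
definition principal_submatrices :: "real mat \<Rightarrow> nat \<Rightarrow> real mat set" where
  "principal_submatrices A k = {submatrix A I I | I. I \<subseteq> {0..<dim_row A} \<and> card I = k}"

definition S_plus :: "nat \<Rightarrow> real mat set" where
  "S_plus n = {X \<in> sym_mats n. (\<forall>M \<in> principal_submatrices X (n - 1). psd_mat M) \<and> det X < 0}"

definition S_plus_plus :: "nat \<Rightarrow> real mat set" where
  "S_plus_plus n = {X \<in> sym_mats n. (\<forall>M \<in> principal_submatrices X (n - 1). pd_mat M) \<and> det X < 0}"

end

theory Submission
  imports Defs "Jordan_Normal_Form.Schur_Decomposition" "HOL-Analysis.Convex"
begin

text \<open>
  The diagonal of \<open>A\<close> is positive, since a zero on the diagonal would force a zero row. Both sides
  of the inequality are multiplied by the same factor when \<open>A\<close> is replaced by \<open>D A D\<close> with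
  \<open>D\<close> diagonal and invertible, so the diagonal may be taken to consist of ones. Call
  the scaled matrix \<open>B\<close>.

  \<^item> \<open>B\<close> has exactly one negative eigenvalue \<open>- \<mu>\<close>, counted with multiplicity. Its characteristic
    polynomial has as derivative the sum of the characteristic polynomials of the principal
    submatrices of size \<open>n - 1\<close>. These are semidefinite, so on the negative axis the derivative has
    constant sign and no zero; by Rolle's theorem there is at most one negative root, and it is
    simple (\<open>negative_eigenvalue_unique\<close>). There is one because \<open>det B < 0\<close>.
  \<^item> \<open>\<mu> \<le> 1 / (n - 2)\<close>. For a vector \<open>v\<close>, let \<open>v\<^sub>i\<close> be \<open>v\<close> with its \<open>i\<close>-th entry set to zero. Summing
    the nonnegative values of the quadratic form of \<open>B\<close> at the \<open>v\<^sub>i\<close> gives \<open>n - 2\<close> times its value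
    at \<open>v\<close>, plus the squared length of \<open>v\<close> (\<open>sum_quadratic_form_delete\<close>). Take for \<open>v\<close> an
    eigenvector of \<open>- \<mu>\<close> (\<open>eigenvalue_lower_bound\<close>).
  \<^item> The trace of \<open>B\<close> is \<open>n\<close>, so the other \<open>n - 1\<close> eigenvalues, which are nonnegative, have sum
    \<open>n + \<mu>\<close>. By the inequality of arithmetic and geometric means
    \<open>- det B \<le> \<mu> ((n + \<mu>) / (n - 1)) ^ (n - 1)\<close>. The right side increases with \<open>\<mu>\<close>, and at
    \<open>\<mu> = 1 / (n - 2)\<close> it is the asserted bound.

  If the submatrices are positive definite, then \<open>\<mu> < 1 / (n - 2)\<close>, and the bound is strict.
\<close>

text \<open>The symbol \<open>\<bullet>\<close> is kept for the scalar product of vectors of variable dimension.\<close>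

unbundle no inner_syntax

section \<open>Quadratic forms\<close>

lemma quadratic_form_expand:
  fixes A :: "real mat"
  assumes "A \<in> carrier_mat n n" and "x \<in> carrier_vec n"
  shows "x \<bullet> (A *\<^sub>v x) = (\<Sum>i<n. \<Sum>j<n. A $$ (i, j) * x $ i * x $ j)"
  using assms
  by (auto simp: scalar_prod_def lessThan_atLeast0 sum_distrib_left mult_ac intro!: sum.cong)

lemma sym_mats_swap:
  assumes "A \<in> sym_mats n" and "i < n" and "j < n"
  shows "A $$ (i, j) = A $$ (j, i)"
proof -
  have "transpose_mat A = A" and "A \<in> carrier_mat n n"
    using assms(1) by (auto simp: sym_mats_def)
  then show ?thesis
    using assms(2,3) by (metis carrier_matD index_transpose_mat(1))
qed

lemma pd_mat_imp_psd_mat: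
  assumes "pd_mat M"
  shows "psd_mat M"
proof -
  obtain n where n: "dim_row M = n"
    by blast
  have M: "M \<in> sym_mats n" and pos: "\<And>x. x \<in> carrier_vec n \<Longrightarrow> x \<noteq> 0\<^sub>v n \<Longrightarrow> 0 < x \<bullet> (M *\<^sub>v x)"
    using assms n by (auto simp: pd_mat_def)
  have cM: "M \<in> carrier_mat n n"
    using M by (simp add: sym_mats_def)
  have "0\<^sub>v n \<bullet> (M *\<^sub>v 0\<^sub>v n) = 0"
    unfolding quadratic_form_expand[OF cM zero_carrier_vec] by simp
  then have "0 \<le> x \<bullet> (M *\<^sub>v x)" if "x \<in> carrier_vec n" for x
    using pos[OF that] by (cases "x = 0\<^sub>v n") simp_all
  then show ?thesis
    using M n by (simp add: psd_mat_def)
qed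

lemma psd_mat_sum_nonneg:
  assumes "psd_mat M" and "dim_row M = n"
  shows "0 \<le> (\<Sum>i<n. \<Sum>j<n. M $$ (i, j) * f i * f j)"
proof -
  have "M \<in> carrier_mat n n" and "0 \<le> vec n f \<bullet> (M *\<^sub>v vec n f)"
    using assms by (auto simp: psd_mat_def sym_mats_def)
  then show ?thesis
    by (simp add: quadratic_form_expand)
qed

lemma pd_mat_sum_pos:
  assumes "pd_mat M" and "dim_row M = n" and "k < n" and "f k \<noteq> 0"
  shows "0 < (\<Sum>i<n. \<Sum>j<n. M $$ (i, j) * f i * f j)"
proof -
  have "vec n f $ k \<noteq> 0\<^sub>v n $ k"
    using assms by simp
  then have "vec n f \<noteq> 0\<^sub>v n"
    by metis
  then have "M \<in> carrier_mat n n" and "0 < vec n f \<bullet> (M *\<^sub>v vec n f)"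
    using assms by (auto simp: pd_mat_def sym_mats_def)
  then show ?thesis
    by (simp add: quadratic_form_expand)
qed

section \<open>Eigenvalues of a real symmetric matrix\<close>

lemma symmetric_complex_eigenvalue_real:
  fixes A :: "real mat"
  assumes A: "A \<in> sym_mats n" and ev: "eigenvalue (map_mat complex_of_real A) k"
  shows "k \<in> \<real>"
proof -
  have cA: "A \<in> carrier_mat n n"
    using A by (auto simp: sym_mats_def)
  from ev cA obtain v where v: "v \<in> carrier_vec n" "v \<noteq> 0\<^sub>v n"
    and Av: "map_mat complex_of_real A *\<^sub>v v = k \<cdot>\<^sub>v v"
    by (auto simp: eigenvalue_def eigenvector_def)
  define N where "N = (\<Sum>i<n. (cmod (v $ i))\<^sup>2)"
  define S where "S = (\<Sum>i<n. \<Sum>j<n. of_real (A $$ (i, j)) * cnj (v $ i) * v $ j)"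
  have row: "(\<Sum>j<n. of_real (A $$ (i, j)) * v $ j) = k * v $ i" if "i < n" for i
  proof -
    have "(map_mat complex_of_real A *\<^sub>v v) $ i = (k \<cdot>\<^sub>v v) $ i"
      using Av by simp
    then show ?thesis
      using that cA v by (simp add: scalar_prod_def lessThan_atLeast0)
  qed
  have "S = (\<Sum>i<n. cnj (v $ i) * (\<Sum>j<n. of_real (A $$ (i, j)) * v $ j))"
    by (simp add: S_def sum_distrib_left mult_ac)
  also have "\<dots> = (\<Sum>i<n. k * of_real ((cmod (v $ i))\<^sup>2))"
  proof (intro sum.cong refl)
    fix i
    assume "i \<in> {..<n}"
    then show "cnj (v $ i) * (\<Sum>j<n. of_real (A $$ (i, j)) * v $ j) =
        k * of_real ((cmod (v $ i))\<^sup>2)"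
      by (simp only: row lessThan_iff) (simp add: complex_norm_square mult_ac del: of_real_power)
  qed
  finally have S: "S = k * of_real N"
    by (simp add: N_def sum_distrib_left)
  have "cnj S = (\<Sum>i<n. \<Sum>j<n. of_real (A $$ (i, j)) * v $ i * cnj (v $ j))"
    by (simp add: S_def)
  also have "\<dots> = (\<Sum>j<n. \<Sum>i<n. of_real (A $$ (i, j)) * v $ i * cnj (v $ j))"
    by (rule sum.swap)
  also have "\<dots> = S"
    unfolding S_def using sym_mats_swap[OF A]
    by (intro sum.cong refl) (simp add: mult_ac)
  finally have "cnj k * of_real N = k * of_real N"
    using S by simp
  moreover have "N \<noteq> 0"
  proof
    assume "N = 0"
    then have "\<forall>i<n. v $ i = 0"
      by (simp add: N_def sum_nonneg_eq_0_iff)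
    then show False
      using v by auto
  qed
  ultimately show ?thesis
    by (simp add: Reals_cnj_iff)
qed

text \<open>The complex roots of the characteristic polynomial are real, so its complex factorization is
  already one over the reals.\<close>

lemma symmetric_char_poly_splits:
  fixes A :: "real mat"
  assumes A: "A \<in> sym_mats n"
  shows "\<exists>es. char_poly A = (\<Prod>e\<leftarrow>es. [:- e, 1:]) \<and> length es = n"
proof -
  have cA: "A \<in> carrier_mat n n"
    using A by (auto simp: sym_mats_def)
  interpret cp: map_poly_inj_comm_ring_hom complex_of_real ..
  let ?C = "map_mat complex_of_real A"
  have cC: "?C \<in> carrier_mat n n"
    using cA by simp
  from char_poly_factorized[OF cC] obtain as
    where as: "char_poly ?C = (\<Prod>a\<leftarrow>as. [:- a, 1:])" and len: "length as = n"
    by blast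
  have real: "of_real (Re a) = a" if "a \<in> set as" for a
  proof -
    have "poly (char_poly ?C) a = 0"
      unfolding as using that by (induction as) auto
    then have "a \<in> \<real>"
      using symmetric_complex_eigenvalue_real[OF A] eigenvalue_root_char_poly[OF cC] by blast
    then show ?thesis
      by simp
  qed
  have "map_poly complex_of_real (char_poly A) = (\<Prod>a\<leftarrow>as. [:- a, 1:])"
    unfolding as[symmetric] by (rule of_real_hom.char_poly_hom[OF cA, symmetric])
  also have "\<dots> = map_poly complex_of_real (\<Prod>e\<leftarrow>map Re as. [:- e, 1:])"
    using real
  proof (induction as)
    case (Cons a as)
    have "map_poly complex_of_real [:- Re a, 1:] = [:- a, 1:]"
      using Cons.prems by simp
    then show ?case
      using Cons by (simp only: list.map prod_list.Cons cp.hom_mult list.set_intros)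
  qed simp
  finally have "char_poly A = (\<Prod>e\<leftarrow>map Re as. [:- e, 1:])"
    by (rule cp.injectivity)
  then show ?thesis
    using len by (metis length_map)
qed

lemma mult_mat_index_sum:
  assumes "X \<in> carrier_mat n n" and "Y \<in> carrier_mat n n" and "i < n" and "j < n"
  shows "(X * Y) $$ (i, j) = (\<Sum>k<n. X $$ (i, k) * Y $$ (k, j))"
  using assms by (simp add: scalar_prod_def lessThan_atLeast0)

lemma trace_similar:
  fixes A B :: "'a :: comm_ring_1 mat"
  assumes "A \<in> carrier_mat n n" and "similar_mat_wit A B P Q"
  shows "(\<Sum>i<n. A $$ (i, i)) = (\<Sum>i<n. B $$ (i, i))"
proof -
  note w = similar_mat_witD2[OF assms]
  have PB: "P * B \<in> carrier_mat n n"
    using w by simp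
  have "(\<Sum>i<n. (P * B * Q) $$ (i, i)) = (\<Sum>i<n. \<Sum>j<n. (P * B) $$ (i, j) * Q $$ (j, i))"
    using w PB by (intro sum.cong refl mult_mat_index_sum) auto
  also have "\<dots> = (\<Sum>j<n. \<Sum>i<n. Q $$ (j, i) * (P * B) $$ (i, j))"
    by (subst sum.swap) (simp add: mult.commute)
  also have "\<dots> = (\<Sum>j<n. (Q * (P * B)) $$ (j, j))"
    using w PB by (intro sum.cong refl mult_mat_index_sum[symmetric]) auto
  also have "Q * (P * B) = Q * P * B"
    by (rule assoc_mult_mat[symmetric, of _ n n _ n _ n]) (use w in simp_all)
  also have "\<dots> = B"
    using w by simp
  finally show ?thesis
    using w by simp
qed

text \<open>The eigenvalues \<open>l 0, \<dots>, l (n - 1)\<close> are listed with their multiplicities as roots of the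
  characteristic polynomial. Determinant and trace are read off from the diagonal of a triangular
  matrix similar to \<open>A\<close>, so an orthonormal basis of eigenvectors is not needed.\<close>

lemma symmetric_eigenvalues:
  fixes A :: "real mat"
  assumes A: "A \<in> sym_mats n"
  shows "\<exists>l. char_poly A = (\<Prod>i<n. [:- l i, 1:]) \<and> det A = (\<Prod>i<n. l i) \<and>
    (\<Sum>i<n. A $$ (i, i)) = (\<Sum>i<n. l i) \<and> (\<forall>i<n. eigenvalue A (l i))"
proof -
  have cA: "A \<in> carrier_mat n n"
    using A by (auto simp: sym_mats_def)
  obtain es where es: "char_poly A = (\<Prod>e\<leftarrow>es. [:- e, 1:])" and len: "length es = n"
    using symmetric_char_poly_splits[OF A] by blast
  obtain B P Q where "schur_decomposition A es = (B, P, Q)"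
    by (metis prod_cases3)
  from schur_decomposition[OF cA es this]
  have sim: "similar_mat_wit A B P Q" and ut: "upper_triangular B" and diag: "diag_mat B = es"
    by auto
  have cB: "B \<in> carrier_mat n n"
    using similar_mat_witD2[OF cA sim] by blast
  have B: "B $$ (i, i) = es ! i" if "i < n" for i
    using that cB diag by (auto simp: diag_mat_def)
  have cp: "char_poly A = (\<Prod>i<n. [:- (es ! i), 1:])"
    unfolding es using len by (simp add: prod.list_conv_set_nth lessThan_atLeast0)
  show ?thesis
  proof (intro exI[of _ "\<lambda>i. es ! i"] conjI allI impI)
    show "char_poly A = (\<Prod>i<n. [:- (es ! i), 1:])"
      by (fact cp)
    have "det A = det B"
      using sim by (intro det_similar) (auto simp: similar_mat_def)
    also have "\<dots> = prod_list es"
      using det_upper_triangular[OF ut cB] diag by simp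
    finally show "det A = (\<Prod>i<n. es ! i)"
      using len by (simp add: prod.list_conv_set_nth lessThan_atLeast0)
    show "(\<Sum>i<n. A $$ (i, i)) = (\<Sum>i<n. es ! i)"
      using trace_similar[OF cA sim] B by simp
    show "eigenvalue A (es ! i)" if "i < n" for i
    proof -
      have "poly (char_poly A) (es ! i) = 0"
        unfolding cp poly_prod using that by (auto intro!: prod_zero)
      then show ?thesis
        using eigenvalue_root_char_poly[OF cA] by blast
    qed
  qed
qed

lemma eigenvector_quadratic_form:
  fixes A :: "real mat"
  assumes cA: "A \<in> carrier_mat n n" and "eigenvalue A k"
  obtains v i where "i < n" "v i \<noteq> 0"
    "(\<Sum>i<n. \<Sum>j<n. A $$ (i, j) * v i * v j) = k * (\<Sum>i<n. (v i)\<^sup>2)"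
proof -
  from assms obtain v where v: "v \<in> carrier_vec n" "v \<noteq> 0\<^sub>v n" and Av: "A *\<^sub>v v = k \<cdot>\<^sub>v v"
    by (auto simp: eigenvalue_def eigenvector_def)
  obtain i where i: "i < n" "v $ i \<noteq> 0"
    using v by (metis carrier_vecD eq_vecI index_zero_vec)
  have "(\<Sum>i<n. \<Sum>j<n. A $$ (i, j) * v $ i * v $ j) = v \<bullet> (k \<cdot>\<^sub>v v)"
    using quadratic_form_expand[OF cA v(1)] Av by simp
  also have "\<dots> = k * (\<Sum>i<n. (v $ i)\<^sup>2)"
    using v(1) by (simp add: scalar_prod_def lessThan_atLeast0 power2_eq_square sum_distrib_left mult_ac)
  finally show thesis
    using that[of i "\<lambda>i. v $ i"] i by blast
qed

text \<open>All roots are nonnegative, so at \<open>x < 0\<close> each of the \<open>m\<close> linear factors is negative.\<close>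

lemma psd_char_poly_sign:
  assumes psd: "psd_mat M" and dim: "dim_row M = m" and "x < 0"
  shows "0 < (- 1) ^ m * poly (char_poly M) x"
proof -
  have M: "M \<in> sym_mats m" and cM: "M \<in> carrier_mat m m"
    using psd dim by (auto simp: psd_mat_def sym_mats_def)
  obtain l where cp: "char_poly M = (\<Prod>i<m. [:- l i, 1:])"
    and ev: "\<And>i. i < m \<Longrightarrow> eigenvalue M (l i)"
    using symmetric_eigenvalues[OF M] by blast
  have nonneg: "0 \<le> l i" if i: "i < m" for i
  proof -
    obtain v k where k: "k < m" "v k \<noteq> 0"
      and "(\<Sum>i<m. \<Sum>j<m. M $$ (i, j) * v i * v j) = l i * (\<Sum>i<m. (v i)\<^sup>2)"
      by (rule eigenvector_quadratic_form[OF cM ev[OF i]])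
    then have "0 \<le> l i * (\<Sum>i<m. (v i)\<^sup>2)"
      using psd_mat_sum_nonneg[OF psd dim, of v] by simp
    moreover have "0 < (\<Sum>i<m. (v i)\<^sup>2)"
      using k by (intro sum_pos2[of _ k]) auto
    ultimately show ?thesis
      by (simp add: zero_le_mult_iff)
  qed
  have "(- 1) ^ m * poly (char_poly M) x = (\<Prod>i<m. (- 1) * (x - l i))"
    unfolding cp poly_prod prod.distrib by (simp add: algebra_simps)
  also have "\<dots> > 0"
    using nonneg \<open>x < 0\<close> by (intro prod_pos) force
  finally show ?thesis .
qed

section \<open>Matrices whose maximal proper principal submatrices are semidefinite\<close>

lemma submatrix_eq_mat_delete:
  assumes A: "A \<in> carrier_mat n n" and i: "i < n"
  shows "submatrix A ({0..<n} - {i}) ({0..<n} - {i}) = mat_delete A i i"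
proof -
  let ?I = "{0..<n} - {i}"
  have set: "{a. a < n \<and> a \<in> ?I} = ?I"
    by auto
  have card: "card ?I = n - 1"
    using i by simp
  have pick: "pick ?I k = insert_index i k" if k: "k < n - 1" for k
  proof -
    have mem: "insert_index i k \<in> ?I"
      using k i by (cases "k < i") auto
    have "card {a \<in> ?I. a < insert_index i k} = k"
    proof (cases "k < i")
      case True
      then have "{a \<in> ?I. a < insert_index i k} = {..<k}"
        using i by auto
      then show ?thesis
        by simp
    next
      case False
      then have "{a \<in> ?I. a < insert_index i k} = {..<Suc k} - {i}"
        using k by auto
      then show ?thesis
        using False by simp
    qed
    then show ?thesis
      using pick_card_in_set[OF mem] by simp
  qed
  show ?thesis
  proof (rule eq_matI)
    show "dim_row (submatrix A ?I ?I) = dim_row (mat_delete A i i)"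
      and "dim_col (submatrix A ?I ?I) = dim_col (mat_delete A i i)"
      using A card set by (simp_all add: dim_submatrix)
    fix r s
    assume "r < dim_row (mat_delete A i i)" and "s < dim_col (mat_delete A i i)"
    then have rs: "r < n - 1" "s < n - 1"
      using A by simp_all
    have "submatrix A ?I ?I $$ (r, s) = A $$ (insert_index i r, insert_index i s)"
      using A rs card set pick by (simp add: submatrix_index)
    also have "\<dots> = mat_delete A i i $$ (r, s)"
      using rs i A by (cases n) (auto intro!: mat_delete_index)
    finally show "submatrix A ?I ?I $$ (r, s) = mat_delete A i i $$ (r, s)" .
  qed
qed

lemma mat_delete_principal_submatrix:
  assumes A: "A \<in> carrier_mat n n" and i: "i < n"
  shows "mat_delete A i i \<in> principal_submatrices A (n - 1)"
proof -
  have "{0..<n} - {i} \<subseteq> {0..<dim_row A}" and "card ({0..<n} - {i}) = n - 1"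
    using A i by auto
  then show ?thesis
    unfolding principal_submatrices_def submatrix_eq_mat_delete[OF A i, symmetric] by blast
qed

text \<open>Deleting row and column \<open>i\<close> amounts to restricting the quadratic form to the vectors whose
  \<open>i\<close>-th entry vanishes.\<close>

lemma mat_delete_quadratic_form:
  fixes A :: "real mat"
  assumes A: "A \<in> carrier_mat n n" and i: "i < n"
  shows "(\<Sum>j<n - 1. \<Sum>k<n - 1. mat_delete A i i $$ (j, k) *
      f (insert_index i j) * f (insert_index i k)) =
    (\<Sum>j\<in>{..<n} - {i}. \<Sum>k\<in>{..<n} - {i}. A $$ (j, k) * f j * f k)"
proof -
  have bij: "bij_betw (insert_index i) {..<n - 1} ({..<n} - {i})"
  proof (rule bij_betw_byWitness[where f' = "delete_index i"])
    show "\<forall>a\<in>{..<n} - {i}. insert_index i (delete_index i a) = a"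
      by (simp add: insert_delete_index)
    show "insert_index i ` {..<n - 1} \<subseteq> {..<n} - {i}"
      using i by (auto simp: insert_index_def)
    show "delete_index i ` ({..<n} - {i}) \<subseteq> {..<n - 1}"
      using i by (auto simp: delete_index_def)
  qed simp
  have entry: "mat_delete A i i $$ (j, k) = A $$ (insert_index i j, insert_index i k)"
    if "j < n - 1" "k < n - 1" for j k
    using that A i by (cases n) (auto intro!: mat_delete_index[symmetric])
  show ?thesis
    unfolding sum.reindex_bij_betw[OF bij, symmetric] by (simp add: entry)
qed

lemma quadratic_form_delete:
  fixes A :: "real mat"
  assumes A: "A \<in> sym_mats n" and i: "i < n"
  shows "(\<Sum>j\<in>{..<n} - {i}. \<Sum>k\<in>{..<n} - {i}. A $$ (j, k) * f j * f k) =
    (\<Sum>j<n. \<Sum>k<n. A $$ (j, k) * f j * f k) - 2 * (\<Sum>j<n. A $$ (i, j) * f i * f j)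
      + A $$ (i, i) * (f i)\<^sup>2"
proof -
  let ?g = "\<lambda>j k. A $$ (j, k) * f j * f k"
  have "(\<Sum>j\<in>{..<n} - {i}. \<Sum>k\<in>{..<n} - {i}. ?g j k) =
      (\<Sum>j<n. (\<Sum>k<n. ?g j k) - ?g j i) - ((\<Sum>k<n. ?g i k) - ?g i i)"
    using i by (simp add: sum_diff1)
  moreover have "(\<Sum>j<n. ?g j i) = (\<Sum>k<n. ?g i k)"
    using sym_mats_swap[OF A _ i] by (intro sum.cong refl) simp
  ultimately show ?thesis
    by (simp add: sum_subtractf power2_eq_square)
qed

text \<open>An off-diagonal term \<open>(j, k)\<close> survives in all summands except \<open>i = j\<close> and \<open>i = k\<close>, a diagonal
  term \<open>(j, j)\<close> in all except \<open>i = j\<close>; the last sum accounts for the difference.\<close>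

lemma sum_quadratic_form_delete:
  fixes A :: "real mat"
  assumes A: "A \<in> sym_mats n"
  shows "(\<Sum>i<n. \<Sum>j\<in>{..<n} - {i}. \<Sum>k\<in>{..<n} - {i}. A $$ (j, k) * f j * f k) =
    (real n - 2) * (\<Sum>j<n. \<Sum>k<n. A $$ (j, k) * f j * f k)
      + (\<Sum>i<n. A $$ (i, i) * (f i)\<^sup>2)"
proof -
  let ?Q = "\<Sum>j<n. \<Sum>k<n. A $$ (j, k) * f j * f k"
  have "(\<Sum>i<n. \<Sum>j\<in>{..<n} - {i}. \<Sum>k\<in>{..<n} - {i}. A $$ (j, k) * f j * f k) =
      (\<Sum>i<n. ?Q - 2 * (\<Sum>j<n. A $$ (i, j) * f i * f j) + A $$ (i, i) * (f i)\<^sup>2)"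
    by (intro sum.cong refl quadratic_form_delete[OF A]) simp
  also have "\<dots> = real n * ?Q - 2 * ?Q + (\<Sum>i<n. A $$ (i, i) * (f i)\<^sup>2)"
    by (simp only: sum.distrib sum_subtractf sum_distrib_left[symmetric] sum_constant card_lessThan)
  finally show ?thesis
    by (simp only: left_diff_distrib)
qed

lemma eigenvalue_lower_bound:
  fixes B :: "real mat"
  assumes n: "n \<ge> 3" and B: "B \<in> sym_mats n" and diag: "\<And>i. i < n \<Longrightarrow> B $$ (i, i) = 1"
    and ev: "eigenvalue B k"
  shows "(\<forall>i<n. psd_mat (mat_delete B i i)) \<Longrightarrow> - (1 / (real n - 2)) \<le> k"
    and "(\<forall>i<n. pd_mat (mat_delete B i i)) \<Longrightarrow> - (1 / (real n - 2)) < k"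
proof -
  have cB: "B \<in> carrier_mat n n"
    using B by (auto simp: sym_mats_def)
  obtain v a where a: "a < n" "v a \<noteq> 0"
    and v: "(\<Sum>i<n. \<Sum>j<n. B $$ (i, j) * v i * v j) = k * (\<Sum>i<n. (v i)\<^sup>2)"
    by (rule eigenvector_quadratic_form[OF cB ev])
  define N where "N = (\<Sum>i<n. (v i)\<^sup>2)"
  have N: "0 < N"
    unfolding N_def using a by (intro sum_pos2[of _ a]) auto
  let ?q = "\<lambda>i. \<Sum>j\<in>{..<n} - {i}. \<Sum>k\<in>{..<n} - {i}. B $$ (j, k) * v j * v k"
  have sum: "(\<Sum>i<n. ?q i) = ((real n - 2) * k + 1) * N"
    unfolding sum_quadratic_form_delete[OF B] v using diag
    by (simp add: N_def algebra_simps)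
  have dim: "dim_row (mat_delete B i i) = n - 1" for i
    using cB by simp
  show "- (1 / (real n - 2)) \<le> k" if psd: "\<forall>i<n. psd_mat (mat_delete B i i)"
  proof -
    have "0 \<le> ?q i" if "i < n" for i
      using psd_mat_sum_nonneg[OF psd[rule_format, OF that] dim, of "\<lambda>j. v (insert_index i j)"]
        mat_delete_quadratic_form[OF cB that, of v] by simp
    then have "0 \<le> (\<Sum>i<n. ?q i)"
      by (rule sum_nonneg) simp
    then have "0 \<le> (real n - 2) * k + 1"
      unfolding sum using N by (simp add: zero_le_mult_iff)
    then show ?thesis
      using n by (simp add: field_simps)
  qed
  show "- (1 / (real n - 2)) < k" if pd: "\<forall>i<n. pd_mat (mat_delete B i i)"
  proof -
    have psd: "psd_mat (mat_delete B i i)" if "i < n" for i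
      using pd that by (blast intro: pd_mat_imp_psd_mat)
    have nonneg: "0 \<le> ?q i" if "i < n" for i
      using psd_mat_sum_nonneg[OF psd[OF that] dim, of "\<lambda>j. v (insert_index i j)"]
        mat_delete_quadratic_form[OF cB that, of v] by simp
    \<comment> \<open>The entry \<open>v a\<close>, which is not zero, is kept when another index \<open>b\<close> is deleted.\<close>
    obtain b where b: "b < n" "b \<noteq> a"
      using n by (metis One_nat_def less_le_trans zero_less_numeral one_less_numeral_iff
          semiring_norm(77) zero_neq_one)
    have "insert_index b (delete_index b a) = a" and "delete_index b a < n - 1"
      using a b by (auto simp: insert_delete_index delete_index_def)
    then have "0 < ?q b"
      using pd_mat_sum_pos[OF pd[rule_format, OF b(1)] dim, of "delete_index b a"
          "\<lambda>j. v (insert_index b j)"] a(2)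
        mat_delete_quadratic_form[OF cB b(1), of v] by simp
    then have "0 < (\<Sum>i<n. ?q i)"
      using b nonneg by (subst sum_pos2[of _ b]) simp_all
    then have "0 < (real n - 2) * k + 1"
      unfolding sum using N by (simp add: zero_less_mult_iff)
    then show ?thesis
      using n by (simp add: field_simps)
  qed
qed

lemma negative_eigenvalue_unique:
  fixes B :: "real mat"
  assumes B: "B \<in> carrier_mat n n" and psd: "\<And>i. i < n \<Longrightarrow> psd_mat (mat_delete B i i)"
    and cp: "char_poly B = (\<Prod>i<n. [:- l i, 1:])"
    and i: "i < n" "l i < 0" and j: "j < n" "l j < 0"
  shows "i = j"
proof (rule ccontr)
  assume "i \<noteq> j"
  let ?p = "char_poly B"
  have nz: "poly (pderiv ?p) x \<noteq> 0" if "x < 0" for x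
  proof -
    have "(- 1) ^ (n - 1) * poly (pderiv ?p) x =
        (\<Sum>i<n. (- 1) ^ (n - 1) * poly (char_poly (mat_delete B i i)) x)"
      unfolding pderiv_char_poly[OF B] poly_sum by (rule sum_distrib_left)
    also have "\<dots> > 0"
      using i(1) B that by (intro sum_pos psd_char_poly_sign psd) auto
    finally show ?thesis
      by auto
  qed
  have root: "poly ?p (l a) = 0" if "a < n" for a
    unfolding cp poly_prod using that by (auto intro!: prod_zero)
  \<comment> \<open>Two distinct negative roots enclose a zero of the derivative, and a double root is one.\<close>
  have False if a: "a < n" "l a < 0" and b: "b < n" "l b < 0" and ab: "l a < l b" for a b
  proof -
    obtain x where "l a < x" "x < l b"
      and "poly ?p (l b) - poly ?p (l a) = (l b - l a) * poly (pderiv ?p) x"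
      using poly_MVT[OF ab] by blast
    then show False
      using root a b ab nz[of x] by simp
  qed
  moreover have False if eq: "l i = l j"
  proof -
    let ?r = "\<Prod>k\<in>{..<n} - {i} - {j}. [:- l k, 1:]"
    define q where "q = [:- l i, 1:]"
    have "?p = q * (q * ?r)"
      unfolding cp q_def using i j \<open>i \<noteq> j\<close> eq
      by (subst prod.remove[of _ i], simp, simp, subst prod.remove[of _ j]) auto
    moreover have "poly q (l i) = 0"
      by (simp add: q_def)
    ultimately have "poly (pderiv ?p) (l i) = 0"
      by (simp add: pderiv_mult)
    then show False
      using nz i by blast
  qed
  ultimately show False
    using i j by (metis linorder_neqE)
qed

text \<open>The inequality of arithmetic and geometric means without roots.\<close>

lemma prod_le_power_mean:
  fixes x :: "'a \<Rightarrow> real"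
  assumes "finite S" and "S \<noteq> {}" and nonneg: "\<And>i. i \<in> S \<Longrightarrow> 0 \<le> x i"
  shows "(\<Prod>i\<in>S. x i) \<le> ((\<Sum>i\<in>S. x i) / card S) ^ card S"
proof -
  have c: "0 < card S"
    using assms by (simp add: card_gt_0_iff)
  have P: "0 \<le> (\<Prod>i\<in>S. x i)"
    using nonneg by (rule prod_nonneg)
  have "(\<Prod>i\<in>S. x i) = ((\<Prod>i\<in>S. x i) powr (1 / card S)) ^ card S"
    using P c by (cases "(\<Prod>i\<in>S. x i) = 0") (auto simp: powr_power)
  also have "\<dots> \<le> ((\<Sum>i\<in>S. x i) / card S) ^ card S"
    using arith_geom_mean[OF assms] by (intro power_mono) (simp_all add: sum_divide_distrib)
  finally show ?thesis .
qed

lemma det_bound_unit_diagonal: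
  fixes B :: "real mat"
  assumes n: "n \<ge> 3" and B: "B \<in> sym_mats n" and diag: "\<And>i. i < n \<Longrightarrow> B $$ (i, i) = 1"
    and psd: "\<And>i. i < n \<Longrightarrow> psd_mat (mat_delete B i i)" and det: "det B < 0"
  shows "det B \<ge> - (1 / (real n - 2)) * ((real n - 1) / (real n - 2)) ^ (n - 1)"
    and "(\<forall>i<n. pd_mat (mat_delete B i i)) \<Longrightarrow>
      det B > - (1 / (real n - 2)) * ((real n - 1) / (real n - 2)) ^ (n - 1)"
proof -
  have cB: "B \<in> carrier_mat n n"
    using B by (auto simp: sym_mats_def)
  obtain l where cp: "char_poly B = (\<Prod>i<n. [:- l i, 1:])"
    and detl: "det B = (\<Prod>i<n. l i)"
    and trl: "(\<Sum>i<n. B $$ (i, i)) = (\<Sum>i<n. l i)"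
    and ev: "\<And>i. i < n \<Longrightarrow> eigenvalue B (l i)"
    using symmetric_eigenvalues[OF B] by blast
  obtain a where a: "a < n" "l a < 0"
    using det unfolding detl by (metis lessThan_iff linorder_not_less prod_nonneg)
  let ?S = "{..<n} - {a}"
  have nonneg: "0 \<le> l i" if "i \<in> ?S" for i
    using negative_eigenvalue_unique[OF cB psd cp _ _ a, of i] that by force
  define \<mu> where "\<mu> = - l a"
  have \<mu>: "0 < \<mu>"
    using a by (simp add: \<mu>_def)
  have card: "card ?S = n - 1"
    using a by simp
  have sum: "(\<Sum>i\<in>?S. l i) = real n + \<mu>"
  proof -
    have "(\<Sum>i<n. l i) = real n"
      using trl diag by simp
    then show ?thesis
      using a by (simp add: sum_diff1 \<mu>_def)
  qed
  have "?S \<noteq> {}"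
    using card n by fastforce
  then have "(\<Prod>i\<in>?S. l i) \<le> ((\<Sum>i\<in>?S. l i) / card ?S) ^ card ?S"
    by (intro prod_le_power_mean nonneg) simp_all
  also have "\<dots> = ((real n + \<mu>) / (real n - 1)) ^ (n - 1)"
    unfolding card sum using n by (subst of_nat_diff) simp_all
  finally have "\<mu> * (\<Prod>i\<in>?S. l i) \<le> \<mu> * ((real n + \<mu>) / (real n - 1)) ^ (n - 1)"
    using \<mu> by (intro mult_left_mono) simp_all
  moreover have "- det B = \<mu> * (\<Prod>i\<in>?S. l i)"
    unfolding detl using a by (subst prod.remove[of _ a]) (auto simp: \<mu>_def)
  ultimately have main: "- det B \<le> \<mu> * ((real n + \<mu>) / (real n - 1)) ^ (n - 1)"
    by simp
  let ?c = "1 / (real n - 2)"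
  \<comment> \<open>At \<open>\<mu> = ?c\<close> the bound \<open>main\<close> becomes the asserted one.\<close>
  have c: "(real n + ?c) / (real n - 1) = (real n - 1) / (real n - 2)"
  proof -
    define w where "w = real n - 2"
    have w: "0 < w"
      using n by (simp add: w_def)
    have "w + 2 + 1 / w = (w + 1) / w * (w + 1)"
      using w by (simp add: field_simps)
    then have "(w + 2 + 1 / w) / (w + 1) = (w + 1) / w"
      using w by simp
    then show ?thesis
      by (simp add: w_def)
  qed
  have mean: "((real n + \<mu>) / (real n - 1)) ^ (n - 1) \<le> ((real n - 1) / (real n - 2)) ^ (n - 1)"
    if "\<mu> \<le> ?c"
    unfolding c[symmetric] using that n \<mu> by (intro power_mono divide_right_mono) auto
  have pos: "0 < ((real n - 1) / (real n - 2)) ^ (n - 1)"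
    using n by simp
  have le: "\<mu> \<le> ?c"
    using eigenvalue_lower_bound(1)[OF n B diag ev[OF a(1)]] psd by (simp add: \<mu>_def)
  have "\<mu> * ((real n + \<mu>) / (real n - 1)) ^ (n - 1) \<le> \<mu> * ((real n - 1) / (real n - 2)) ^ (n - 1)"
    using mean[OF le] \<mu> by (intro mult_left_mono) simp_all
  with main have bound: "- det B \<le> \<mu> * ((real n - 1) / (real n - 2)) ^ (n - 1)"
    by (rule order_trans)
  also have "\<dots> \<le> ?c * ((real n - 1) / (real n - 2)) ^ (n - 1)"
    using le pos by (intro mult_right_mono) auto
  finally show "det B \<ge> - ?c * ((real n - 1) / (real n - 2)) ^ (n - 1)"
    by simp
  show "det B > - ?c * ((real n - 1) / (real n - 2)) ^ (n - 1)"
    if "\<forall>i<n. pd_mat (mat_delete B i i)"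
  proof -
    have "\<mu> < ?c"
      using eigenvalue_lower_bound(2)[OF n B diag ev[OF a(1)]] that by (simp add: \<mu>_def)
    then have "\<mu> * ((real n - 1) / (real n - 2)) ^ (n - 1) <
        ?c * ((real n - 1) / (real n - 2)) ^ (n - 1)"
      using pos by (rule mult_strict_right_mono)
    with bound show ?thesis
      by simp
  qed
qed

section \<open>Reduction to unit diagonal\<close>

text \<open>The matrix \<open>D A D\<close> for the diagonal matrix \<open>D\<close> with entries \<open>d 0, d 1, \<dots>\<close>. The scaling factors are
  a function on all natural numbers, of which only the values below the dimension matter.\<close>

definition diag_scale :: "(nat \<Rightarrow> real) \<Rightarrow> real mat \<Rightarrow> real mat" where
  "diag_scale d A = mat (dim_row A) (dim_col A) (\<lambda>(i, j). d i * A $$ (i, j) * d j)"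

lemma diag_scale_simps [simp]:
  "dim_row (diag_scale d A) = dim_row A"
  "dim_col (diag_scale d A) = dim_col A"
  "i < dim_row A \<Longrightarrow> j < dim_col A \<Longrightarrow> diag_scale d A $$ (i, j) = d i * A $$ (i, j) * d j"
  by (simp_all add: diag_scale_def)

lemma diag_scale_sym_mats:
  assumes "A \<in> sym_mats n"
  shows "diag_scale d A \<in> sym_mats n"
proof -
  have cA: "A \<in> carrier_mat n n"
    using assms by (auto simp: sym_mats_def)
  then show ?thesis
    unfolding sym_mats_def using sym_mats_swap[OF assms]
    by (auto intro!: eq_matI simp: mult_ac)
qed

lemma diag_scale_quadratic_form:
  assumes A: "A \<in> carrier_mat n n" and x: "x \<in> carrier_vec n"
  shows "x \<bullet> (diag_scale d A *\<^sub>v x) = vec n (\<lambda>i. d i * x $ i) \<bullet> (A *\<^sub>v vec n (\<lambda>i. d i * x $ i))"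
proof -
  have "diag_scale d A \<in> carrier_mat n n"
    using A by auto
  then show ?thesis
    using A x by (simp add: quadratic_form_expand mult_ac)
qed

lemma psd_mat_diag_scale:
  assumes "psd_mat A"
  shows "psd_mat (diag_scale d A)"
proof -
  obtain n where n: "dim_row A = n"
    by blast
  have A: "A \<in> sym_mats n" and nonneg: "\<And>x. x \<in> carrier_vec n \<Longrightarrow> 0 \<le> x \<bullet> (A *\<^sub>v x)"
    using assms n by (auto simp: psd_mat_def)
  have cA: "A \<in> carrier_mat n n"
    using A by (simp add: sym_mats_def)
  have "0 \<le> x \<bullet> (diag_scale d A *\<^sub>v x)" if "x \<in> carrier_vec n" for x
    unfolding diag_scale_quadratic_form[OF cA that] by (rule nonneg) simp
  then show ?thesis
    using diag_scale_sym_mats[OF A] n by (simp add: psd_mat_def)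
qed

lemma pd_mat_diag_scale:
  assumes "pd_mat A" and d: "\<And>i. i < dim_row A \<Longrightarrow> d i \<noteq> 0"
  shows "pd_mat (diag_scale d A)"
proof -
  obtain n where n: "dim_row A = n"
    by blast
  have A: "A \<in> sym_mats n" and pos: "\<And>x. x \<in> carrier_vec n \<Longrightarrow> x \<noteq> 0\<^sub>v n \<Longrightarrow> 0 < x \<bullet> (A *\<^sub>v x)"
    using assms n by (auto simp: pd_mat_def)
  have cA: "A \<in> carrier_mat n n"
    using A by (simp add: sym_mats_def)
  have "0 < x \<bullet> (diag_scale d A *\<^sub>v x)" if x: "x \<in> carrier_vec n" "x \<noteq> 0\<^sub>v n" for x
    unfolding diag_scale_quadratic_form[OF cA x(1)]
  proof (rule pos)
    obtain i where i: "i < n" "x $ i \<noteq> 0"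
      using x by (metis carrier_vecD eq_vecI index_zero_vec)
    then have "vec n (\<lambda>i. d i * x $ i) $ i \<noteq> 0\<^sub>v n $ i"
      using d n by simp
    then show "vec n (\<lambda>i. d i * x $ i) \<noteq> 0\<^sub>v n"
      by metis
  qed simp
  then show ?thesis
    using diag_scale_sym_mats[OF A] n by (simp add: pd_mat_def)
qed

lemma mat_delete_diag_scale:
  assumes A: "A \<in> carrier_mat n n" and i: "i < n"
  shows "mat_delete (diag_scale d A) i i = diag_scale (\<lambda>j. d (insert_index i j)) (mat_delete A i i)"
  by (rule eq_matI) (use A i in \<open>auto simp: mat_delete_def insert_index_def\<close>)

lemma det_diag_scale:
  assumes A: "A \<in> carrier_mat n n"
  shows "det (diag_scale d A) = (\<Prod>i<n. d i)\<^sup>2 * det A"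
proof -
  have "diag_scale d A \<in> carrier_mat n n"
    using A by auto
  then have "det (diag_scale d A) =
      (\<Sum>p | p permutes {0..<n}. signof p * (\<Prod>i = 0..<n. d i * A $$ (i, p i) * d (p i)))"
    unfolding det_def' using A
    by (subst det_def') (auto intro!: sum.cong prod.cong)
  also have "\<dots> = (\<Sum>p | p permutes {0..<n}.
      (\<Prod>i<n. d i)\<^sup>2 * (signof p * (\<Prod>i = 0..<n. A $$ (i, p i))))"
  proof (intro sum.cong refl)
    fix p
    assume "p \<in> {p. p permutes {0..<n}}"
    then have "(\<Prod>i = 0..<n. d (p i)) = (\<Prod>i = 0..<n. d i)"
      using prod.permute[of p "{0..<n}" d] by (simp add: o_def)
    then show "signof p * (\<Prod>i = 0..<n. d i * A $$ (i, p i) * d (p i)) =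
        (\<Prod>i<n. d i)\<^sup>2 * (signof p * (\<Prod>i = 0..<n. A $$ (i, p i)))"
      by (simp add: prod.distrib lessThan_atLeast0 power2_eq_square)
  qed
  also have "\<dots> = (\<Prod>i<n. d i)\<^sup>2 * det A"
    unfolding det_def'[OF A] by (rule sum_distrib_left[symmetric])
  finally show ?thesis .
qed

lemma zero_row_det:
  fixes A :: "'a :: comm_ring_1 mat"
  assumes A: "A \<in> carrier_mat n n" and i: "i < n" and z: "\<And>j. j < n \<Longrightarrow> A $$ (i, j) = 0"
  shows "det A = 0"
  unfolding det_def'[OF A]
proof (intro sum.neutral ballI)
  fix p
  assume "p \<in> {p. p permutes {0..<n}}"
  then have "p i < n"
    using i permutes_in_image[of p "{0..<n}" i] by simp
  then have "(\<Prod>i = 0..<n. A $$ (i, p i)) = 0"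
    using i z by (intro prod_zero) (auto intro!: bexI[of _ i])
  then show "signof p * (\<Prod>i = 0..<n. A $$ (i, p i)) = 0"
    by simp
qed

text \<open>Since \<open>n \<ge> 3\<close>, every \<open>2 \<times> 2\<close> principal submatrix lies in one of size \<open>n - 1\<close> and is semidefinite.
  If \<open>A $$ (i, i) = 0\<close>, this forces all of row \<open>i\<close> to vanish.\<close>

lemma diagonal_pos:
  fixes A :: "real mat"
  assumes n: "n \<ge> 3" and A: "A \<in> sym_mats n"
    and psd: "\<And>i. i < n \<Longrightarrow> psd_mat (mat_delete A i i)" and det: "det A \<noteq> 0" and i: "i < n"
  shows "0 < A $$ (i, i)"
proof -
  have cA: "A \<in> carrier_mat n n"
    using A by (auto simp: sym_mats_def)
  have binary: "0 \<le> s\<^sup>2 * A $$ (i, i) + 2 * s * t * A $$ (i, j) + t\<^sup>2 * A $$ (j, j)"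
    if j: "j < n" "j \<noteq> i" for s t j
  proof -
    obtain k where k: "k < n" "k \<noteq> i" "k \<noteq> j"
    proof -
      have "card {i, j} < card {..<n}"
        using n j by simp
      then have "\<not> {..<n} \<subseteq> {i, j}"
        using card_mono[of "{i, j}" "{..<n}"] by fastforce
      then show thesis
        using that by blast
    qed
    define f where "f = (\<lambda>a. if a = i then s else if a = j then t else 0)"
    have "dim_row (mat_delete A k k) = n - 1"
      using cA by simp
    from psd_mat_sum_nonneg[OF psd[OF k(1)] this, of "\<lambda>a. f (insert_index k a)"]
    have "0 \<le> (\<Sum>a\<in>{..<n} - {k}. \<Sum>b\<in>{..<n} - {k}. A $$ (a, b) * f a * f b)"
      using mat_delete_quadratic_form[OF cA k(1), of f] by simp
    also have "\<dots> = (\<Sum>a\<in>{i, j}. \<Sum>b\<in>{i, j}. A $$ (a, b) * f a * f b)"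
    proof (rule sum.mono_neutral_cong_right)
      fix a
      assume "a \<in> {i, j}"
      show "(\<Sum>b\<in>{..<n} - {k}. A $$ (a, b) * f a * f b) =
          (\<Sum>b\<in>{i, j}. A $$ (a, b) * f a * f b)"
        using i j k by (intro sum.mono_neutral_right) (auto simp: f_def)
    qed (use i j k in \<open>auto simp: f_def\<close>)
    also have "\<dots> = s\<^sup>2 * A $$ (i, i) + 2 * s * t * A $$ (i, j) + t\<^sup>2 * A $$ (j, j)"
      using j sym_mats_swap[OF A i j(1)] by (simp add: f_def power2_eq_square algebra_simps)
    finally show ?thesis .
  qed
  obtain j0 where j0: "j0 < n" "j0 \<noteq> i"
    using n by (metis One_nat_def less_le_trans zero_less_numeral one_less_numeral_iff
        semiring_norm(77) zero_neq_one)
  have "0 \<le> A $$ (i, i)"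
    using binary[OF j0, of 1 0] by simp
  moreover have "A $$ (i, i) \<noteq> 0"
  proof
    assume z: "A $$ (i, i) = 0"
    have "A $$ (i, j) = 0" if j: "j < n" for j
    proof (cases "j = i")
      case False
      \<comment> \<open>The value \<open>2 s A $$ (i, j) + A $$ (j, j)\<close> of the form is \<open>- 1\<close> at \<open>s = ?s\<close>.\<close>
      let ?s = "- (A $$ (j, j) + 1) / (2 * A $$ (i, j))"
      show ?thesis
      proof (rule ccontr)
        assume "A $$ (i, j) \<noteq> 0"
        then have "2 * ?s * A $$ (i, j) = - (A $$ (j, j) + 1)"
          by simp
        then show False
          using binary[OF j False, of ?s 1] unfolding z by simp
      qed
    qed (simp add: z)
    then show False
      using zero_row_det[OF cA i] det by blast
  qed
  ultimately show ?thesis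
    by simp
qed

theorem theorem1p1:
  fixes n :: nat and A :: "real mat"
  assumes "n \<ge> 3" and "A \<in> S_plus n"
  shows "det A \<ge> - (1 / (real n - 2)) * ((real n - 1) / (real n - 2)) ^ (n - 1) * (\<Prod>i = 0..<n. A $$ (i, i))
    \<and> (A \<in> S_plus_plus n \<longrightarrow>
      det A > - (1 / (real n - 2)) * ((real n - 1) / (real n - 2)) ^ (n - 1) * (\<Prod>i = 0..<n. A $$ (i, i)))"
proof -
  have A: "A \<in> sym_mats n" and det: "det A < 0"
    and sub: "\<And>M. M \<in> principal_submatrices A (n - 1) \<Longrightarrow> psd_mat M"
    using assms(2) by (auto simp: S_plus_def)
  have cA: "A \<in> carrier_mat n n"
    using A by (auto simp: sym_mats_def)
  have psd: "psd_mat (mat_delete A i i)" if "i < n" for i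
    using sub mat_delete_principal_submatrix[OF cA that] by blast
  have pos: "0 < A $$ (i, i)" if "i < n" for i
    using diagonal_pos[OF assms(1) A psd _ that] det by simp
  define d where "d = (\<lambda>i. 1 / sqrt (A $$ (i, i)))"
  define B where "B = diag_scale d A"
  define D where "D = (\<Prod>i = 0..<n. A $$ (i, i))"
  let ?b = "- (1 / (real n - 2)) * ((real n - 1) / (real n - 2)) ^ (n - 1)"
  have D: "0 < D"
    unfolding D_def using pos by (intro prod_pos) auto
  have d2: "(d i)\<^sup>2 = 1 / A $$ (i, i)" if "i < n" for i
    using pos[OF that] by (simp add: d_def power_divide)
  have "(\<Prod>i<n. d i)\<^sup>2 = (\<Prod>i<n. 1 / A $$ (i, i))"
    unfolding prod_power_distrib using d2 by (intro prod.cong) auto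
  also have "\<dots> = 1 / D"
    by (simp add: D_def lessThan_atLeast0 prod_dividef)
  finally have detB: "det B = det A / D"
    by (simp add: B_def det_diag_scale[OF cA])
  have B: "B \<in> sym_mats n"
    unfolding B_def by (rule diag_scale_sym_mats[OF A])
  have diagB: "B $$ (i, i) = 1" if "i < n" for i
  proof -
    have "B $$ (i, i) = (d i)\<^sup>2 * A $$ (i, i)"
      using that cA by (simp add: B_def power2_eq_square)
    then show ?thesis
      using d2[OF that] pos[OF that] by simp
  qed
  have psdB: "psd_mat (mat_delete B i i)" if "i < n" for i
    unfolding B_def mat_delete_diag_scale[OF cA that] by (intro psd_mat_diag_scale psd that)
  have detB_neg: "det B < 0"
    unfolding detB using det D by (simp add: divide_neg_pos)
  note bound = det_bound_unit_diagonal[OF assms(1) B diagB psdB detB_neg]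
  have "?b * D \<le> det A"
    using bound(1) D unfolding detB by (simp add: pos_le_divide_eq)
  moreover have "?b * D < det A" if pp: "A \<in> S_plus_plus n"
  proof -
    have "pd_mat (mat_delete B i i)" if i: "i < n" for i
      unfolding B_def mat_delete_diag_scale[OF cA i]
    proof (rule pd_mat_diag_scale)
      show "pd_mat (mat_delete A i i)"
        using pp mat_delete_principal_submatrix[OF cA i] by (auto simp: S_plus_plus_def)
      show "d (insert_index i j) \<noteq> 0" if "j < dim_row (mat_delete A i i)" for j
      proof -
        have "insert_index i j < n"
          using that cA by (auto simp: insert_index_def)
        then show ?thesis
          using pos by (force simp: d_def)
      qed
    qed
    then have "?b < det A / D"
      using bound(2) unfolding detB by blast
    then show ?thesis
      using D by (simp add: pos_less_divide_eq)
  qed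
  ultimately show ?thesis
    unfolding D_def by blast
qed

end
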